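(* For $Q\in\mathrm{Gr}(k,n)$ and $X,Y\in\mathbb{T}_Q\mathrm{Gr}(k,n)$ written as \[ Q=VI_{k,n-k}V^{\mathsf T},\qquad X=V\begin{bmatrix}0 & B \\ B^{\mathsf T} & 0\end{bmatrix}V^{\mathsf T},\qquad Y=V\begin{bmatrix}0 & C \\ C^{\mathsf T} & 0\end{bmatrix}V^{\mathsf T}, \] with $V\in\mathrm{O}(n)$ and $B,C\in\mathbb{R}^{k\times(n-k)}$, \[ R_Q(X)=V\,\mathcal{C}\left(\frac14\begin{bmatrix}0 & -B \\ B^{\mathsf T} & 0\end{bmatrix}\right)I_{k,n-k}\,\mathcal{C}\left(\frac14\begin{bmatrix}0 & -B \\ B^{\mathsf T} & 0\end{bmatrix}\right)^{\mathsf T}V^{\mathsf T} \] defines a retraction on $\mathrm{Gr}(k,n)$, and \[ T_Q(X,Y)=V\,\mathcal{C}\left(\frac14\begin{bmatrix}0 & -B \\ B^{\mathsf T} & 0\end{bmatrix}\right)\begin{bmatrix}0 & C \\ C^{\mathsf T} & 0\end{bmatrix}\mathcal{C}\left(\frac14\begin{bmatrix}0 & -B \\ B^{\mathsf T} & 0\end{bmatrix}\right)^{\mathsf T}V^{\mathsf T} \] defines a vector transport associated to this retraction (that is, $T_{Q,X}(Y):=T_Q(X,Y)$ is the transport of $Y$ in the direction $X$).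
   Context: For $k\in\{1,\dots,n\}$, $\mathrm{Gr}(k,n)=\{Q\in\mathrm{O}(n):Q^{\mathsf T}=Q,\ \operatorname{tr}(Q)=2k-n\}$, an embedded submanifold of $\mathbb{R}^{n\times n}$; $I_{k,n-k}=\operatorname{diag}(I_k,-I_{n-k})$; every $Q\in\mathrm{Gr}(k,n)$ can be written $Q=VI_{k,n-k}V^{\mathsf T}$ with $V\in\mathrm{O}(n)$ (not unique), and then $\mathbb{T}_Q\mathrm{Gr}(k,n)=\bigl\{V\begin{bmatrix}0 & B \\ B^{\mathsf T} & 0\end{bmatrix}V^{\mathsf T}:B\in\mathbb{R}^{k\times(n-k)}\bigr\}$. The Cayley transform $\mathcal{C}$ sends a skew-symmetric $n\times n$ matrix $\Lambda$ to $\mathcal{C}(\Lambda)=(I+\Lambda)(I-\Lambda)^{-1}\in\mathrm{O}(n)$. A map $R:\mathbb{T}M\to M$, $(x,v)\mapsto R_x(v)$, is a retraction if (a) $R_x(0)=x$ for all $x\in M$, and (b) $dR_x(0):\mathbb{T}_xM\to\mathbb{T}_xM$ is the identity map for all $x\in M$ (identifying $\mathbb{T}_0(\mathbb{T}_xM)$ with $\mathbb{T}_xM$). A map $T:\mathbb{T}M\oplus\mathbb{T}M\to\mathbb{T}M$ is a vector transport associated to a retraction $R$ if (i) $T(x,v,w)=(R_x(v),T_{x,v}(w))$ for all $x\in M$, $v,w\in\mathbb{T}_xM$ (so $T_{x,v}(w)\in\mathbb{T}_{R_x(v)}M$); (ii) $T_{x,0}(w)=w$ for all $x\in M$, $w\in\mathbb{T}_xM$;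 (iii) $T_{x,v}(a_1w_1+a_2w_2)=a_1T_{x,v}(w_1)+a_2T_{x,v}(w_2)$ for all $a_1,a_2\in\mathbb{R}$, $x\in M$, $v,w_1,w_2\in\mathbb{T}_xM$. *)

theory Defs
  imports "HOL-Analysis.Analysis"
begin

section \<open>Embedded submanifolds, retractions and vector transports\<close>

text \<open>
  The tangent space at \<open>x\<close> of a submanifold \<open>M\<close> of a normed space consists of the velocities at
  time \<open>0\<close> of continuously differentiable curves in \<open>M\<close> passing through \<open>x\<close>.
\<close>

definition tangent_space :: "'a::real_normed_vector set \<Rightarrow> 'a \<Rightarrow> 'a set" where
  "tangent_space M x = {v. \<exists>\<gamma> e. e > 0 \<and> \<gamma> ` {-e<..<e} \<subseteq> M \<and> \<gamma> C1_differentiable_on {-e<..<e} \<and>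
     \<gamma> 0 = x \<and> (\<gamma> has_vector_derivative v) (at 0)}"

text \<open>
  Maps on bundles are total functions whose values matter only on the bundle. As the tangent space
  at \<open>x\<close> is a linear subspace of the ambient space, the differential at \<open>0\<close> of
  \<open>R x\<close> as a map on that subspace is its derivative at \<open>0\<close> within the subspace.
\<close>

definition manifold_retraction ::
  "'a::real_normed_vector set \<Rightarrow> ('a \<Rightarrow> 'a \<Rightarrow> 'a) \<Rightarrow> bool" where
  "manifold_retraction M R \<longleftrightarrow>
     (\<forall>x\<in>M. \<forall>v\<in>tangent_space M x. R x v \<in> M) \<and>
     (\<forall>x\<in>M. R x 0 = x) \<and>
     (\<forall>x\<in>M. (R x has_derivative (\<lambda>v. v)) (at 0 within tangent_space M x))"

text \<open>
  \<open>T (x, v, w)\<close> is an element of the tangent bundle, i.e. a pair of a base point and a tangent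
  vector there; its second component is what is usually written \<open>T\<^bsub>x,v\<^esub>(w)\<close>.
\<close>

definition vector_transport ::
  "'a::real_normed_vector set \<Rightarrow> ('a \<Rightarrow> 'a \<Rightarrow> 'a) \<Rightarrow> ('a \<times> 'a \<times> 'a \<Rightarrow> 'a \<times> 'a) \<Rightarrow> bool" where
  "vector_transport M R T \<longleftrightarrow>
     manifold_retraction M R \<and>
     (\<forall>x\<in>M. \<forall>v\<in>tangent_space M x. \<forall>w\<in>tangent_space M x.
        fst (T (x, v, w)) = R x v \<and> snd (T (x, v, w)) \<in> tangent_space M (R x v)) \<and>
     (\<forall>x\<in>M. \<forall>w\<in>tangent_space M x. snd (T (x, 0, w)) = w) \<and>
     (\<forall>a\<^sub>1 a\<^sub>2. \<forall>x\<in>M. \<forall>v\<in>tangent_space M x. \<forall>w\<^sub>1\<in>tangent_space M x. \<forall>w\<^sub>2\<in>tangent_space M x.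
        snd (T (x, v, a\<^sub>1 *\<^sub>R w\<^sub>1 + a\<^sub>2 *\<^sub>R w\<^sub>2)) =
          a\<^sub>1 *\<^sub>R snd (T (x, v, w\<^sub>1)) + a\<^sub>2 *\<^sub>R snd (T (x, v, w\<^sub>2)))"


section \<open>Block matrices and the Cayley transform\<close>

text \<open>
  The size \<open>n\<close> of the matrices is \<open>CARD('n)\<close>; rows and columns are ordered by the linear order on
  \<open>'n\<close>, and \<open>pos i\<close> is the position of \<open>i\<close>, counted from \<open>0\<close>. Blocks are functions
  of two natural-number indices: in \<open>block_mat k A B C D\<close> the block \<open>A\<close> is \<open>k\<times>k\<close>, \<open>B\<close> is
  \<open>k\<times>(n-k)\<close>, \<open>C\<close> is \<open>(n-k)\<times>k\<close> and \<open>D\<close> is \<open>(n-k)\<times>(n-k)\<close>;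
  entries outside these ranges are never used. For \<open>k = n\<close> only \<open>A\<close> is present.
\<close>

type_synonym 'n sqmat = "((real, 'n) vec, 'n) vec"

definition pos :: "'n::{finite,linorder} \<Rightarrow> nat" where
  "pos i = card {j. j < i}"

definition block_mat ::
  "nat \<Rightarrow> (nat \<Rightarrow> nat \<Rightarrow> real) \<Rightarrow> (nat \<Rightarrow> nat \<Rightarrow> real) \<Rightarrow> (nat \<Rightarrow> nat \<Rightarrow> real) \<Rightarrow> (nat \<Rightarrow> nat \<Rightarrow> real) \<Rightarrow>
     'n::{finite,linorder} sqmat" where
  "block_mat k A B C D = (\<chi> i j.
     if pos i < k then (if pos j < k then A (pos i) (pos j) else B (pos i) (pos j - k))
     else (if pos j < k then C (pos i - k) (pos j) else D (pos i - k) (pos j - k)))"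

definition signature_mat :: "nat \<Rightarrow> 'n::{finite,linorder} sqmat" where
  "signature_mat k = block_mat k (\<lambda>p q. if p = q then 1 else 0) (\<lambda>p q. 0)
                                 (\<lambda>p q. 0) (\<lambda>p q. if p = q then -1 else 0)"

definition sym_block :: "nat \<Rightarrow> (nat \<Rightarrow> nat \<Rightarrow> real) \<Rightarrow> 'n::{finite,linorder} sqmat" where
  "sym_block k B = block_mat k (\<lambda>p q. 0) B (\<lambda>p q. B q p) (\<lambda>p q. 0)"

definition skew_block :: "nat \<Rightarrow> (nat \<Rightarrow> nat \<Rightarrow> real) \<Rightarrow> 'n::{finite,linorder} sqmat" where
  "skew_block k B = block_mat k (\<lambda>p q. 0) (\<lambda>p q. - B p q) (\<lambda>p q. B q p) (\<lambda>p q. 0)"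

text \<open>Meant for skew-symmetric arguments, for which \<open>I - L\<close> is always invertible.\<close>

definition cayley :: "'n::finite sqmat \<Rightarrow> 'n sqmat" where
  "cayley L = (mat 1 + L) ** matrix_inv (mat 1 - L)"


section \<open>The Grassmannian in the involution model\<close>

definition Gr :: "nat \<Rightarrow> ('n::finite sqmat) set" where
  "Gr k = {Q. orthogonal_matrix Q \<and> transpose Q = Q \<and> trace Q = 2 * real k - real CARD('n)}"

text \<open>
  The two formulas below refer to a representation of the data by \<open>V\<close>, \<open>B\<close>, \<open>C\<close>, which is not
  unique. The predicates demand the prescribed value for every representation, so that the
  existence of such a map expresses that the formula is independent of the representation.
\<close>

definition given_by_retraction_formula ::
  "nat \<Rightarrow> ('n::{finite,linorder} sqmat \<Rightarrow> 'n sqmat \<Rightarrow> 'n sqmat) \<Rightarrow> bool" where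
  "given_by_retraction_formula k R \<longleftrightarrow>
     (\<forall>Q\<in>Gr k. \<forall>X\<in>tangent_space (Gr k) Q. \<forall>V B.
        orthogonal_matrix V \<and>
        Q = V ** signature_mat k ** transpose V \<and>
        X = V ** sym_block k B ** transpose V \<longrightarrow>
        R Q X = V ** cayley ((1/4) *\<^sub>R skew_block k B) ** signature_mat k
                  ** transpose (cayley ((1/4) *\<^sub>R skew_block k B)) ** transpose V)"

definition given_by_transport_formula ::
  "nat \<Rightarrow> ('n::{finite,linorder} sqmat \<Rightarrow> 'n sqmat \<Rightarrow> 'n sqmat \<Rightarrow> 'n sqmat) \<Rightarrow> bool" where
  "given_by_transport_formula k T \<longleftrightarrow>
     (\<forall>Q\<in>Gr k. \<forall>X\<in>tangent_space (Gr k) Q. \<forall>Y\<in>tangent_space (Gr k) Q. \<forall>V B C.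
        orthogonal_matrix V \<and>
        Q = V ** signature_mat k ** transpose V \<and>
        X = V ** sym_block k B ** transpose V \<and>
        Y = V ** sym_block k C ** transpose V \<longrightarrow>
        T Q X Y = V ** cayley ((1/4) *\<^sub>R skew_block k B) ** sym_block k C
                    ** transpose (cayley ((1/4) *\<^sub>R skew_block k B)) ** transpose V)"

end

theory Submission imports Defs begin

text \<open>
  The block matrices satisfy \<open>sym_block k B ** signature_mat k = skew_block k B\<close>, so conjugating by
  \<open>V\<close> turns the Cayley factor into \<open>W = \<C>(XQ/4)\<close>, which does not involve \<open>V\<close>. The formulas become
  \<open>R\<^sub>Q(X) = W Q W\<^sup>T\<close> and \<open>T\<^sub>Q(X, Y) = W Y W\<^sup>T\<close>. The tangent space at \<open>Q\<close> consists of the symmetric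
  \<open>X\<close> with \<open>XQ + QX = 0\<close>: differentiate \<open>\<gamma>\<^sup>T = \<gamma>\<close> and \<open>\<gamma>\<gamma> = I\<close>, and conversely use the curve
  \<open>t \<mapsto> R\<^sub>Q(tX)\<close>. As \<open>L = XQ/4\<close> anticommutes with \<open>Q\<close>, we have \<open>Q W\<^sup>T = W Q\<close>, hence
  \<open>R\<^sub>Q(X) - Q - X = (W\<^sup>2 - I - 4L) Q\<close>, which is \<open>L\<^sup>2\<close> times a bounded factor because \<open>W\<close> is
  orthogonal. This gives the differential of the retraction at \<open>0\<close>.
\<close>

section \<open>Matrix algebra, orthogonal matrices and inverses\<close>

text \<open>Besides the algebraic rules collected below, this supplies the product rule, continuity
  and norm estimates for matrix products.\<close>

lemma bounded_bilinear_matrix_mult: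
  "bounded_bilinear ((**) :: real^'n^'m \<Rightarrow> real^'p^'n \<Rightarrow> real^'p^'m)"
proof -
  have "bilinear ((**) :: real^'n^'m \<Rightarrow> real^'p^'n \<Rightarrow> real^'p^'m)"
    unfolding bilinear_def
    by (auto intro!: linearI simp: vec_eq_iff matrix_matrix_mult_def sum.distrib sum_distrib_left
        algebra_simps)
  then show ?thesis
    by (simp add: bilinear_conv_bounded_bilinear)
qed

lemmas matrix_mult_simps =
  bounded_bilinear.add_left[OF bounded_bilinear_matrix_mult]
  bounded_bilinear.add_right[OF bounded_bilinear_matrix_mult]
  bounded_bilinear.diff_left[OF bounded_bilinear_matrix_mult]
  bounded_bilinear.diff_right[OF bounded_bilinear_matrix_mult]
  bounded_bilinear.minus_left[OF bounded_bilinear_matrix_mult]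
  bounded_bilinear.minus_right[OF bounded_bilinear_matrix_mult]
  bounded_bilinear.scaleR_left[OF bounded_bilinear_matrix_mult]
  bounded_bilinear.scaleR_right[OF bounded_bilinear_matrix_mult]

lemma bounded_linear_transpose: "bounded_linear (transpose :: real^'n^'m \<Rightarrow> real^'m^'n)"
  by (simp add: linear_conv_bounded_linear[symmetric] linear_iff vec_eq_iff transpose_def)

lemmas transpose_simps =
  bounded_linear.linear[OF bounded_linear_transpose, THEN linear_add]
  bounded_linear.linear[OF bounded_linear_transpose, THEN linear_diff]
  bounded_linear.linear[OF bounded_linear_transpose, THEN linear_neg]
  transpose_scalar matrix_transpose_mul

lemma orthogonal_matrixD:
  fixes V :: "real^'n^'n"
  assumes "orthogonal_matrix V"
  shows "transpose V ** V = mat 1" "V ** transpose V = mat 1"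
    "transpose V ** (V ** A) = A" "V ** (transpose V ** A) = A"
  using assms by (auto simp: orthogonal_matrix_def matrix_mul_assoc)

text \<open>Each row has norm 1, and the norm of a matrix is at most the sum of its row norms.
  Through this crude bound every Cayley factor is bounded independently of its argument.\<close>

lemma norm_orthogonal_matrix_le:
  fixes W :: "real^'n^'n"
  assumes "orthogonal_matrix W"
  shows "norm W \<le> real CARD('n)"
proof -
  have "norm W \<le> (\<Sum>i\<in>UNIV. norm (W $ i))"
    unfolding norm_vec_def[of W] by (intro L2_set_le_sum) auto
  also have "\<dots> = real CARD('n)"
    using assms by (simp add: orthogonal_matrix_orthonormal_rows row_def)
  finally show ?thesis .
qed

text \<open>A one-sided inverse of a square matrix is two-sided, and two-sided inverses are unique,
  so the choice made in \<open>matrix_inv\<close> is forced.\<close>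

lemma matrix_inv_eq:
  fixes A B :: "real^'n^'n"
  assumes "A ** B = mat 1"
  shows "matrix_inv A = B"
proof -
  have BA: "B ** A = mat 1"
    using assms matrix_left_right_inverse by blast
  have "A ** matrix_inv A = mat 1 \<and> matrix_inv A ** A = mat 1"
    unfolding matrix_inv_def by (rule someI[of _ B]) (use assms BA in auto)
  then show ?thesis
    by (metis BA matrix_mul_assoc matrix_mul_lid matrix_mul_rid)
qed

section \<open>The Cayley transform of a skew-symmetric matrix\<close>

text \<open>If \<open>A *v x = x\<close>, then skew-symmetry makes <x, Ax> equal to its own
  negative, so |x|^2 = 0. Hence I - A is injective and, being square, invertible.\<close>

lemma skew_resolvent:
  fixes A :: "real^'n^'n"
  assumes "transpose A = - A"
  shows "(mat 1 - A) ** matrix_inv (mat 1 - A) = mat 1"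
    "matrix_inv (mat 1 - A) ** (mat 1 - A) = mat 1"
proof -
  have "x = 0" if "(mat 1 - A) *v x = 0" for x
  proof -
    have x: "A *v x = x"
      using that by (simp add: matrix_vector_mult_diff_rdistrib)
    have "inner x (A *v x) = inner (transpose A *v x) x"
      by (simp add: dot_lmul_matrix flip: vector_transpose_matrix)
    also have "\<dots> = - inner x (A *v x)"
      unfolding assms
      by (simp add: inner_commute matrix_vector_mult_def inner_vec_def sum_negf)
    finally show "x = 0"
      by (simp add: x)
  qed
  then obtain B where "B ** (mat 1 - A) = mat 1"
    using matrix_left_invertible_ker[of "mat 1 - A"] by blast
  then have B: "(mat 1 - A) ** B = mat 1" "B ** (mat 1 - A) = mat 1"
    using matrix_left_right_inverse by blast+
  then show "(mat 1 - A) ** matrix_inv (mat 1 - A) = mat 1"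
    "matrix_inv (mat 1 - A) ** (mat 1 - A) = mat 1"
    using matrix_inv_eq[OF B(1)] by auto
qed

text \<open>Write I + A = 2I - (I - A). The Cayley transform is thus affine in the resolvent, so
  transposition, conjugation and differentiation need only be studied for the resolvent.\<close>

lemma cayley_resolvent:
  fixes A :: "real^'n^'n"
  assumes "transpose A = - A"
  shows "cayley A = 2 *\<^sub>R matrix_inv (mat 1 - A) - mat 1"
proof -
  have "mat 1 + A = 2 *\<^sub>R mat 1 - (mat 1 - A)"
    by (simp add: scaleR_2)
  then show ?thesis
    unfolding cayley_def
    by (metis matrix_mult_simps(3,7) matrix_mul_lid skew_resolvent(1)[OF assms])
qed

lemma transpose_cayley:
  fixes A :: "real^'n^'n"
  assumes "transpose A = - A"
  shows "transpose (cayley A) = cayley (- A)"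
proof -
  have A': "transpose (- A) = - (- A)"
    using assms by (simp add: transpose_simps)
  have "transpose (matrix_inv (mat 1 - A) ** (mat 1 - A)) = mat 1"
    by (simp add: skew_resolvent(2)[OF assms])
  then have "(mat 1 - (- A)) ** transpose (matrix_inv (mat 1 - A)) = mat 1"
    by (simp add: transpose_simps assms)
  then have "matrix_inv (mat 1 - (- A)) = transpose (matrix_inv (mat 1 - A))"
    by (rule matrix_inv_eq)
  then show ?thesis
    unfolding cayley_resolvent[OF assms] cayley_resolvent[OF A']
    by (simp add: transpose_simps)
qed

text \<open>The transpose of the Cayley transform is (I + A)^(-1) (I - A). In the product with (I +
  A)(I - A)^(-1) the two middle factors commute, and everything cancels.\<close>

lemma orthogonal_matrix_cayley:
  fixes A :: "real^'n^'n"
  assumes "transpose A = - A"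
  shows "orthogonal_matrix (cayley A)"
proof -
  let ?M = "matrix_inv (mat 1 + A)" and ?N = "matrix_inv (mat 1 - A)"
  have M: "?M ** (mat 1 + A) = mat 1"
    using skew_resolvent[of "- A"] assms by (simp add: transpose_simps)
  have N: "(mat 1 - A) ** ?N = mat 1"
    by (rule skew_resolvent[OF assms])
  have T: "transpose ?N = ?M"
  proof -
    have "transpose (?N ** (mat 1 - A)) = mat 1"
      by (simp add: skew_resolvent(2)[OF assms])
    then show ?thesis
      by (intro matrix_inv_eq[symmetric]) (simp add: transpose_simps assms)
  qed
  have "transpose (cayley A) ** cayley A = ?M ** ((mat 1 - A) ** (mat 1 + A)) ** ?N"
    by (simp add: cayley_def transpose_simps assms T matrix_mul_assoc)
  also have "(mat 1 - A) ** (mat 1 + A) = (mat 1 + A) ** (mat 1 - A)"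
    by (simp add: matrix_mult_simps algebra_simps)
  also have "?M ** ((mat 1 + A) ** (mat 1 - A)) ** ?N = mat 1"
    by (metis M N matrix_mul_assoc matrix_mul_lid)
  finally show ?thesis
    by (simp add: orthogonal_matrix)
qed

lemma skew_conj:
  fixes A V :: "real^'n^'n"
  assumes "transpose A = - A"
  shows "transpose (V ** A ** transpose V) = - (V ** A ** transpose V)"
  by (simp add: transpose_simps matrix_mult_simps assms matrix_mul_assoc)

text \<open>Orthogonality of V gives I - V A V^T = V (I - A) V^T, so the resolvent is conjugated
  along with A.\<close>

lemma cayley_conj:
  fixes A V :: "real^'n^'n"
  assumes "transpose A = - A" "orthogonal_matrix V"
  shows "cayley (V ** A ** transpose V) = V ** cayley A ** transpose V"
proof -
  note V = orthogonal_matrixD[OF assms(2)]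
  have "mat 1 - V ** A ** transpose V = V ** (mat 1 - A) ** transpose V"
    by (simp add: matrix_mult_simps V)
  then have "(mat 1 - V ** A ** transpose V) ** (V ** matrix_inv (mat 1 - A) ** transpose V) =
      V ** ((mat 1 - A) ** matrix_inv (mat 1 - A)) ** transpose V"
    by (simp add: matrix_mul_assoc[symmetric] V)
  then have "matrix_inv (mat 1 - V ** A ** transpose V) = V ** matrix_inv (mat 1 - A) ** transpose V"
    by (intro matrix_inv_eq) (simp add: skew_resolvent[OF assms(1)] V)
  then show ?thesis
    by (simp add: cayley_resolvent skew_conj assms matrix_mult_simps V)
qed

text \<open>With N the resolvent, A N = N - I and I + \<open>cayley A\<close> = 2N. The identity
  serves to extract a left factor A from \<open>cayley A - mat 1\<close>.\<close>

lemma cayley_fixpoint: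
  fixes A :: "real^'n^'n"
  assumes "transpose A = - A"
  shows "cayley A = mat 1 + A ** (mat 1 + cayley A)"
proof -
  let ?N = "matrix_inv (mat 1 - A)"
  have "A ** ?N = ?N - mat 1"
    using skew_resolvent(1)[OF assms] by (auto simp: matrix_mult_simps algebra_simps)
  then show ?thesis
    unfolding cayley_resolvent[OF assms] by (simp add: matrix_mult_simps vec_eq_iff)
qed

text \<open>The factor A is extracted twice: first from W^2 - I = (W - I)(W + I), then from (I +
  W)^2 - 4I = (W - I)(W + 3I).\<close>

lemma cayley_square_remainder:
  fixes A :: "real^'n^'n"
  assumes "transpose A = - A"
  defines "W \<equiv> cayley A"
  shows "W ** W - mat 1 - 4 *\<^sub>R A = A ** A ** (mat 1 + W) ** (W + 3 *\<^sub>R mat 1)"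
proof -
  have W: "W - mat 1 = A ** (mat 1 + W)"
    using cayley_fixpoint[OF assms(1)] by (simp add: W_def algebra_simps)
  have "W ** W - mat 1 = (W - mat 1) ** (W + mat 1)"
    by (simp add: matrix_mult_simps algebra_simps)
  also have "\<dots> = A ** ((mat 1 + W) ** (W + mat 1))"
    by (subst W) (simp add: matrix_mul_assoc)
  finally have "W ** W - mat 1 - 4 *\<^sub>R A = A ** ((mat 1 + W) ** (W + mat 1) - 4 *\<^sub>R mat 1)"
    by (simp add: matrix_mult_simps)
  also have "(mat 1 + W) ** (W + mat 1) - 4 *\<^sub>R mat 1 = (W - mat 1) ** (W + 3 *\<^sub>R mat 1)"
    by (simp add: matrix_mult_simps vec_eq_iff)
  also have "A ** ((W - mat 1) ** (W + 3 *\<^sub>R mat 1)) = A ** A ** (mat 1 + W) ** (W + 3 *\<^sub>R mat 1)"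
    by (subst W) (simp add: matrix_mul_assoc)
  finally show ?thesis .
qed

section \<open>Signature, block matrices and diagonalization of involutions\<close>

lemma inj_pos: "inj (pos :: 'n::{finite,linorder} \<Rightarrow> nat)"
proof (rule linorder_injI)
  fix x y :: 'n
  assume "x < y"
  then have "{j. j < x} \<subset> {j. j < y}" by auto
  then show "pos x \<noteq> pos y"
    unfolding pos_def using psubset_card_mono[of "{j. j < y}" "{j. j < x}"] by auto
qed

lemma pos_less: "pos (i :: 'n::{finite,linorder}) < CARD('n)"
  unfolding pos_def by (intro psubset_card_mono) auto

lemma bij_betw_pos: "bij_betw (pos :: 'n::{finite,linorder} \<Rightarrow> nat) UNIV {..<CARD('n)}"
  unfolding bij_betw_def
  by (intro conjI inj_pos card_subset_eq) (auto simp: pos_less card_image inj_pos)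

lemma card_pos_less:
  assumes "d \<le> CARD('n)"
  shows "card {i :: 'n::{finite,linorder}. pos i < d} = d"
proof -
  have "pos ` {i :: 'n. pos i < d} = range (pos :: 'n \<Rightarrow> nat) \<inter> {..<d}"
    by auto
  also have "\<dots> = {..<d}"
    using assms bij_betw_imp_surj_on[OF bij_betw_pos[where 'n='n]] by auto
  finally have "pos ` {i :: 'n. pos i < d} = {..<d}" .
  then show ?thesis
    by (metis card_image card_lessThan inj_pos inj_on_subset subset_UNIV)
qed

lemma signature_mat_nth:
  "(signature_mat k :: 'n::{finite,linorder} sqmat) $ i $ j =
     (if i = j then if pos i < k then 1 else - 1 else 0)"
proof -
  have "pos i = pos j \<longleftrightarrow> i = j"
    using inj_pos by (auto dest: injD)
  then show ?thesis
    by (auto simp: signature_mat_def block_mat_def)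
qed

lemma mult_signature_mat_nth:
  "(A ** (signature_mat k :: 'n::{finite,linorder} sqmat)) $ i $ j =
     (if pos j < k then A $ i $ j else - A $ i $ j)"
  "((signature_mat k :: 'n::{finite,linorder} sqmat) ** B) $ i $ j =
     (if pos i < k then B $ i $ j else - B $ i $ j)"
proof -
  let ?c = "\<lambda>i :: 'n. if pos i < k then 1 else - 1 :: real"
  have "(\<Sum>l\<in>UNIV. A $ i $ l * (signature_mat k :: 'n sqmat) $ l $ j) =
      (\<Sum>l\<in>UNIV. if l = j then A $ i $ l * ?c l else 0)"
    by (intro sum.cong) (auto simp: signature_mat_nth)
  then show "(A ** (signature_mat k :: 'n sqmat)) $ i $ j =
      (if pos j < k then A $ i $ j else - A $ i $ j)"
    by (simp add: matrix_matrix_mult_def)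
  have "(\<Sum>l\<in>UNIV. (signature_mat k :: 'n sqmat) $ i $ l * B $ l $ j) =
      (\<Sum>l\<in>UNIV. if i = l then ?c l * B $ l $ j else 0)"
    by (intro sum.cong) (auto simp: signature_mat_nth)
  then show "((signature_mat k :: 'n sqmat) ** B) $ i $ j =
      (if pos i < k then B $ i $ j else - B $ i $ j)"
    by (simp add: matrix_matrix_mult_def)
qed

lemma trace_signature_mat:
  assumes "d \<le> CARD('n)"
  shows "trace (signature_mat d :: 'n::{finite,linorder} sqmat) = 2 * real d - real CARD('n)"
proof -
  have "trace (signature_mat d :: 'n sqmat) = (\<Sum>i::'n\<in>UNIV. 2 * (if pos i < d then 1 else 0) - 1)"
    unfolding trace_def signature_mat_nth by (intro sum.cong) auto
  also have "\<dots> = 2 * real d - real CARD('n)"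
    by (simp add: sum_subtractf card_pos_less[OF assms] flip: sum_distrib_left sum.inter_filter)
  finally show ?thesis .
qed

text \<open>Right multiplication by the signature matrix negates the columns from position k on,
  which changes only the upper right block of \<open>sym_block k B\<close>.\<close>

lemma sym_block_mult_signature_mat:
  "sym_block k B ** signature_mat k = (skew_block k B :: 'n::{finite,linorder} sqmat)"
  by (simp add: vec_eq_iff mult_signature_mat_nth)
    (simp add: sym_block_def skew_block_def block_mat_def)

lemma transpose_skew_block: "transpose (skew_block k B) = - skew_block k B"
  by (simp add: vec_eq_iff transpose_def skew_block_def block_mat_def)

text \<open>At an entry of a diagonal block the two products have the same sign, so anticommuting
  forces 2 Z_ij = 0 there. Symmetry then determines the lower left block from the upper right
  one.\<close>

lemma sym_block_exists:
  fixes Z :: "'n::{finite,linorder} sqmat"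
  assumes sym: "transpose Z = Z"
    and anti: "Z ** signature_mat k + signature_mat k ** Z = 0"
  obtains B where "Z = sym_block k B"
proof
  \<comment> \<open>Block columns are counted from 0, so column q of the block sits at position q +
    k of the matrix.\<close>
  define B where "B = (\<lambda>p q. Z $ (inv pos p) $ (inv pos (q + k)))"
  have inv: "inv pos (pos i) = i" for i :: 'n
    by (simp add: inj_pos)
  have z: "Z $ i $ j = 0" if "pos i < k \<longleftrightarrow> pos j < k" for i j
  proof -
    have "(Z ** signature_mat k + signature_mat k ** Z) $ i $ j = 0"
      by (simp add: anti)
    then show ?thesis
      using that by (auto simp: mult_signature_mat_nth split: if_splits)
  qed
  have "Z $ j $ i = Z $ i $ j" for i j
    using sym by (auto simp: vec_eq_iff transpose_def)
  then show "Z = sym_block k B"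
    by (auto simp: vec_eq_iff sym_block_def block_mat_def z B_def inv)
qed


text \<open>As Q^2 = I, the space is the sum of the eigenspaces for 1 and -1, and symmetry of Q
  makes them orthogonal. Orthonormal bases of the two, the one for 1 first, are the columns of V; d
  is the dimension of the eigenspace for 1.\<close>

lemma involution_diagonalization:
  fixes Q :: "'n::{finite,linorder} sqmat"
  assumes Q: "orthogonal_matrix Q" "transpose Q = Q"
  obtains V d where "orthogonal_matrix V" "d \<le> CARD('n)" "Q = V ** signature_mat d ** transpose V"
proof -
  let ?E = "{x. Q *v x = x}" and ?F = "{x. Q *v x = - x}"
  have neg: "Q *v (- x) = - (Q *v x)" for x
    using matrix_vector_mult_scaleR[of Q "-1" x] by simp
  have QQ: "Q *v (Q *v x) = x" for x
    using Q by (simp add: matrix_vector_mul_assoc orthogonal_matrix_def)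
  have E: "subspace ?E" and F: "subspace ?F"
    by (auto simp: subspace_def matrix_vector_right_distrib matrix_vector_mult_scaleR)
  obtain B where B: "B \<subseteq> ?E" "pairwise orthogonal B" "\<And>x. x \<in> B \<Longrightarrow> norm x = 1"
      "independent B" "span B = ?E"
    by (rule orthonormal_basis_subspace[OF E]) blast
  obtain C where C: "C \<subseteq> ?F" "pairwise orthogonal C" "\<And>x. x \<in> C \<Longrightarrow> norm x = 1"
      "independent C" "span C = ?F"
    by (rule orthonormal_basis_subspace[OF F]) blast
  have fin: "finite B" "finite C"
    using B(4) C(4) independent_imp_finite by auto
  have BC: "inner x y = 0" if "x \<in> B" "y \<in> C" for x y
  proof -
    have "inner x y = inner (Q *v x) y"
      using B(1) that by auto
    also have "\<dots> = inner x (Q *v y)"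
      by (metis Q(2) dot_lmul_matrix vector_transpose_matrix)
    also have "\<dots> = - inner x y"
      using C(1) that by auto
    finally show ?thesis by simp
  qed
  have "B \<inter> C = {}"
    using BC B(3) by (metis disjoint_iff inner_eq_zero_iff norm_zero zero_neq_one)
  \<comment> \<open>The vectors (x + Qx)/2 and (x - Qx)/2 are the components of x in the two
    eigenspaces.\<close>
  have "x \<in> span (B \<union> C)" for x
  proof -
    have "(1/2) *\<^sub>R (x + Q *v x) \<in> span B"
      by (simp add: B(5) matrix_vector_right_distrib matrix_vector_mult_scaleR QQ add.commute)
    moreover have "(1/2) *\<^sub>R (x - Q *v x) \<in> span C"
      by (simp add: C(5) matrix_vector_mult_diff_distrib matrix_vector_mult_scaleR QQ vec_eq_iff field_simps)
    ultimately have "(1/2) *\<^sub>R (x + Q *v x) + (1/2) *\<^sub>R (x - Q *v x) \<in> span (B \<union> C)"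
      by (meson span_add span_mono subsetD sup_ge1 sup_ge2)
    also have "(1/2) *\<^sub>R (x + Q *v x) + (1/2) *\<^sub>R (x - Q *v x) = x"
      by (simp add: vec_eq_iff field_simps)
    finally show ?thesis .
  qed
  then have span: "span (B \<union> C) = UNIV" by auto
  have orth: "pairwise orthogonal (B \<union> C)"
    using B(2) C(2) BC BC[THEN inner_commute[THEN trans]] by (auto simp: pairwise_def orthogonal_def)
  have "independent (B \<union> C)"
    using orth B(3) C(3) by (intro pairwise_orthogonal_independent) fastforce+
  then have "card (B \<union> C) = CARD('n)"
    using dim_eq_card[of "B \<union> C" UNIV] span by simp
  then have card: "card B + card C = CARD('n)"
    by (simp add: card_Un_disjoint fin \<open>B \<inter> C = {}\<close>)
  obtain g h where g: "bij_betw g {..<card B} B" and h: "bij_betw h {..<card C} C"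
    using fin ex_bij_betw_nat_finite[of B] ex_bij_betw_nat_finite[of C] by (auto simp: atLeast0LessThan)
  \<comment> \<open>The basis is enumerated along \<open>pos\<close>: the vectors of
    \<open>B\<close> occupy the first \<open>card B\<close> positions, those of \<open>C\<close> the
    rest, matching the signs of the signature matrix.\<close>
  define f where "f = (\<lambda>i::'n. if pos i < card B then g (pos i) else h (pos i - card B))"
  have fB: "f i \<in> B" if "pos i < card B" for i
    using that g by (auto simp: f_def bij_betw_def)
  have fC: "f i \<in> C" if "\<not> pos i < card B" for i
    using that h card pos_less[of i] by (auto simp: f_def bij_betw_def)
  have "i = j" if "f i = f j" for i j
  proof -
    have "pos i < card B \<longleftrightarrow> pos j < card B"
      using fB fC that \<open>B \<inter> C = {}\<close> by (metis disjoint_iff)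
    moreover have "pos i - card B = pos j - card B" if "\<not> pos i < card B" "\<not> pos j < card B"
      using that \<open>f i = f j\<close> h card pos_less[of i] pos_less[of j]
      by (auto simp: f_def bij_betw_def dest!: inj_onD)
    moreover have "pos i = pos j" if "pos i < card B" "pos j < card B"
      using that \<open>f i = f j\<close> g by (auto simp: f_def bij_betw_def dest!: inj_onD)
    ultimately have "pos i = pos j" by (metis eq_diff_iff not_less)
    then show ?thesis using inj_pos by (auto dest: injD)
  qed
  then have inj: "inj f" by (rule injI)
  define V :: "'n sqmat" where "V = (\<chi> i j. f j $ i)"
  have col: "column j V = f j" for j
    by (simp add: V_def column_def vec_eq_iff)
  have V: "orthogonal_matrix V"
    unfolding orthogonal_matrix_orthonormal_columns col
  proof (intro conjI allI impI)
    show "norm (f i) = 1" for i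
      using fB fC B(3) C(3) by blast
    show "orthogonal (f i) (f j)" if "i \<noteq> j" for i j
      using pairwiseD[OF orth, of "f i" "f j"] fB fC injD[OF inj, of i j] that by blast
  qed
  have "(Q ** V) $ i $ j = (V ** signature_mat (card B)) $ i $ j" for i j
  proof -
    have "(Q ** V) $ i $ j = (Q *v f j) $ i"
      by (simp add: matrix_matrix_mult_def matrix_vector_mult_def V_def)
    also have "Q *v f j = (if pos j < card B then f j else - f j)"
      using fB[of j] fC[of j] B(1) C(1) by auto
    finally show ?thesis
      by (simp add: mult_signature_mat_nth V_def)
  qed
  then have "Q ** V = V ** signature_mat (card B)"
    by (simp add: vec_eq_iff)
  then have "Q = V ** signature_mat (card B) ** transpose V"
    by (metis V matrix_mul_assoc matrix_mul_rid orthogonal_matrix_def)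
  with V card show thesis
    by (intro that[of V "card B"]) auto
qed

section \<open>Derivatives\<close>

lemma has_derivative_quadratic_remainder:
  fixes f :: "'a::real_normed_vector \<Rightarrow> 'b::real_normed_vector"
  assumes "bounded_linear F"
    and "\<And>y. y \<in> S \<Longrightarrow> norm (f y - f x - F (y - x)) \<le> C * (norm (y - x))\<^sup>2"
  shows "(f has_derivative F) (at x within S)"
proof (rule has_derivativeI_sandwich[of 1 _ _ _ _ "\<lambda>y. C * norm (y - x)"])
  show "norm (f y - f x - F (y - x)) / norm (y - x) \<le> C * norm (y - x)"
    if "y \<in> S" "y \<noteq> x" for y
    using assms(2)[OF that(1)] that(2) by (simp add: divide_simps power2_eq_square mult.assoc)
  have "((\<lambda>y. C * norm (y - x)) \<longlongrightarrow> C * norm (x - x)) (at x within S)"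
    by (intro tendsto_intros)
  then show "((\<lambda>y. C * norm (y - x)) \<longlongrightarrow> 0) (at x within S)"
    by simp
qed (use assms(1) in auto)

lemma norm_matrix_mult_bound:
  obtains K where "K > 0" "\<And>(A :: real^'n^'n) (B :: real^'n^'n). norm (A ** B) \<le> norm A * norm B * K"
proof -
  obtain K where "K > 0" "\<forall>(A :: real^'n^'n) (B :: real^'n^'n). norm (A ** B) \<le> norm A * norm B * K"
    using bounded_bilinear.pos_bounded[OF bounded_bilinear_matrix_mult[where 'n='n and 'm='n and 'p='n]]
    by auto
  then show thesis
    by (intro that) auto
qed

text \<open>The resolvent is half the sum of two orthogonal matrices, the Cayley transform and the
  identity.\<close>

lemma norm_skew_resolvent_le:
  fixes A :: "real^'n^'n"
  assumes "transpose A = - A"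
  shows "norm (matrix_inv (mat 1 - A)) \<le> real CARD('n)"
proof -
  have "matrix_inv (mat 1 - A) = (1/2) *\<^sub>R (cayley A + mat 1)"
    by (simp add: cayley_resolvent[OF assms])
  moreover have "norm (cayley A + mat 1) \<le> real CARD('n) + real CARD('n)"
    using assms by (intro norm_triangle_le add_mono norm_orthogonal_matrix_le
        orthogonal_matrix_cayley orthogonal_matrix_id)
  ultimately show ?thesis by simp
qed

lemma skew_scaleR:
  fixes A :: "real^'n^'n"
  shows "transpose A = - A \<Longrightarrow> transpose (t *\<^sub>R A) = - (t *\<^sub>R A)"
  by (simp add: transpose_simps)

text \<open>The resolvent identity N(s) - N(t) = (s - t) N(s) A N(t), applied twice, leaves the
  remainder (s - t)^2 N(s) A N(t) A N(t). It is quadratic because N(s) is bounded uniformly in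
  s.\<close>

lemma has_vector_derivative_skew_resolvent:
  fixes A :: "real^'n^'n"
  assumes "transpose A = - A"
  defines "N \<equiv> \<lambda>t. matrix_inv (mat 1 - t *\<^sub>R A)"
  shows "(N has_vector_derivative N t ** A ** N t) (at t)"
proof -
  have inv: "N t ** (mat 1 - t *\<^sub>R A) = mat 1" "(mat 1 - t *\<^sub>R A) ** N t = mat 1" for t
    unfolding N_def by (rule skew_resolvent skew_scaleR assms)+
  have diff: "N s - N t = (s - t) *\<^sub>R (N s ** A ** N t)" for s t
  proof -
    have "N s - N t = N s ** ((mat 1 - t *\<^sub>R A) ** N t) - (N s ** (mat 1 - s *\<^sub>R A)) ** N t"
      by (simp only: inv matrix_mul_lid matrix_mul_rid)
    also have "\<dots> = N s ** (((mat 1 - t *\<^sub>R A) - (mat 1 - s *\<^sub>R A)) ** N t)"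
      by (simp add: matrix_mult_simps matrix_mul_assoc)
    also have "(mat 1 - t *\<^sub>R A) - (mat 1 - s *\<^sub>R A) = (s - t) *\<^sub>R A"
      by (simp add: scaleR_left_diff_distrib)
    finally show ?thesis
      by (simp add: matrix_mult_simps matrix_mul_assoc)
  qed
  obtain K where K: "K > 0" "\<And>(A :: real^'n^'n) (B :: real^'n^'n). norm (A ** B) \<le> norm A * norm B * K"
    by (rule norm_matrix_mult_bound) blast
  \<comment> \<open>The part of the remainder that does not depend on s.\<close>
  define Z where "Z = A ** N t ** A ** N t"
  show ?thesis
    unfolding has_vector_derivative_def
  proof (rule has_derivative_quadratic_remainder)
    show "bounded_linear (\<lambda>x. x *\<^sub>R (N t ** A ** N t))"
      by (rule bounded_linear_scaleR_left)
    fix s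
    have "N s - N t - (s - t) *\<^sub>R (N t ** A ** N t) = (s - t) *\<^sub>R ((N s - N t) ** A ** N t)"
      by (subst diff) (simp add: matrix_mult_simps scaleR_right_diff_distrib)
    also have "\<dots> = (s - t)\<^sup>2 *\<^sub>R (N s ** Z)"
      unfolding diff Z_def by (simp add: matrix_mult_simps matrix_mul_assoc power2_eq_square)
    finally have "norm (N s - N t - (s - t) *\<^sub>R (N t ** A ** N t)) = norm (N s ** Z) * (s - t)\<^sup>2"
      by simp
    also have "norm (N s ** Z) \<le> real CARD('n) * norm Z * K"
    proof -
      have "norm (N s) \<le> real CARD('n)"
        unfolding N_def by (intro norm_skew_resolvent_le skew_scaleR assms)
      then have "norm (N s) * norm Z * K \<le> real CARD('n) * norm Z * K"
        using K(1) by (intro mult_right_mono) auto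
      then show ?thesis
        using K(2)[of "N s" Z] by linarith
    qed
    finally show "norm (N s - N t - (s - t) *\<^sub>R (N t ** A ** N t))
        \<le> real CARD('n) * norm Z * K * (norm (s - t))\<^sup>2"
      by (simp add: mult_right_mono mult.commute)
  qed
qed

section \<open>The tangent spaces of the Grassmannian\<close>

lemma Gr_D:
  assumes "Q \<in> Gr k"
  shows "Q ** Q = mat 1" "transpose Q = Q" "orthogonal_matrix Q"
  using assms by (auto simp: Gr_def orthogonal_matrix_def)

lemma Gr_conj:
  fixes W Q :: "'n::finite sqmat"
  assumes "orthogonal_matrix W" "Q \<in> Gr k"
  shows "W ** Q ** transpose W \<in> Gr k"
proof -
  have "trace (W ** Q ** transpose W) = trace (transpose W ** (W ** Q))"
    by (rule trace_mul_sym)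
  also have "\<dots> = trace Q"
    by (simp add: orthogonal_matrixD[OF assms(1)])
  finally show ?thesis
    using assms by (auto simp: Gr_def orthogonal_matrix_mul transpose_simps matrix_mul_assoc)
qed

text \<open>Diagonalization yields some signature d; comparing traces, 2k - n = 2d - n, gives d =
  k.\<close>

lemma Gr_representative:
  fixes Q :: "'n::{finite,linorder} sqmat"
  assumes "Q \<in> Gr k"
  obtains V where "orthogonal_matrix V" "Q = V ** signature_mat k ** transpose V"
proof -
  obtain V d where V: "orthogonal_matrix V" "d \<le> CARD('n)" "Q = V ** signature_mat d ** transpose V"
    using involution_diagonalization Gr_D[OF assms] by blast
  have "2 * real k - real CARD('n) = trace Q"
    using assms by (simp add: Gr_def)
  also have "\<dots> = trace (transpose V ** (V ** signature_mat d))"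
    unfolding V(3) by (rule trace_mul_sym)
  also have "\<dots> = 2 * real d - real CARD('n)"
    by (simp add: orthogonal_matrixD[OF V(1)] trace_signature_mat V(2))
  finally show thesis
    using V that by simp
qed

text \<open>The linearization of the equations \<open>transpose Q = Q\<close> and
  \<open>Q ** Q = mat 1\<close>; \<open>tangent_space_Gr\<close> identifies it with the tangent
  space at points of the Grassmannian.\<close>

definition gr_tangent :: "'n::finite sqmat \<Rightarrow> 'n sqmat set" where
  "gr_tangent Q = {X. transpose X = X \<and> X ** Q + Q ** X = 0}"

text \<open>The Cayley factor of both formulas, conjugated by V and thereby expressed through Q and
  X alone; see \<open>gr_cayley_representative\<close>.\<close>

definition gr_cayley :: "'n::finite sqmat \<Rightarrow> 'n sqmat \<Rightarrow> 'n sqmat" where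
  "gr_cayley Q X = cayley ((1/4) *\<^sub>R (X ** Q))"

lemma gr_tangent_skew:
  fixes Q X :: "'n::finite sqmat"
  assumes "Q \<in> Gr k" "X \<in> gr_tangent Q"
  shows "transpose (c *\<^sub>R (X ** Q)) = - (c *\<^sub>R (X ** Q))"
proof -
  have "Q ** X = - (X ** Q)"
    using assms(2) by (simp add: gr_tangent_def eq_neg_iff_add_eq_0 add.commute)
  then show ?thesis
    using assms by (simp add: transpose_simps Gr_D gr_tangent_def)
qed

text \<open>Conjugation by Q sends c XQ to its negative, hence W to W^T, so Q W^T = W Q. The general
  c covers both the retraction (c = 1/4) and the curve t |-> R_Q(tX) (c = t/4).\<close>

lemma conj_eq_cayley_square:
  fixes Q X :: "'n::finite sqmat" and c :: real
  assumes Q: "Q \<in> Gr k" and X: "X \<in> gr_tangent Q"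
  defines "W \<equiv> cayley (c *\<^sub>R (X ** Q))"
  shows "W ** Q ** transpose W = W ** W ** Q"
proof -
  have "Q ** X = - (X ** Q)"
    using X by (simp add: gr_tangent_def eq_neg_iff_add_eq_0 add.commute)
  then have "Q ** (c *\<^sub>R (X ** Q)) ** transpose Q = - (c *\<^sub>R (X ** Q))"
    by (simp add: Gr_D[OF Q] matrix_mult_simps matrix_mul_assoc)
      (simp add: Gr_D[OF Q] matrix_mult_simps flip: matrix_mul_assoc)
  then have "transpose W = Q ** W ** transpose Q"
    unfolding W_def using transpose_cayley cayley_conj gr_tangent_skew[OF Q X] Gr_D(3)[OF Q] by metis
  then have "Q ** transpose W = W ** Q"
    by (simp add: Gr_D[OF Q] matrix_mul_assoc)
  then show ?thesis
    by (simp flip: matrix_mul_assoc)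
qed

lemma tangent_space_Gr_subset:
  fixes Q :: "'n::finite sqmat"
  assumes Q: "Q \<in> Gr k"
  shows "tangent_space (Gr k) Q \<subseteq> gr_tangent Q"
proof
  fix X
  assume "X \<in> tangent_space (Gr k) Q"
  then obtain \<gamma> e where e: "e > 0" and Gr: "\<gamma> ` {-e<..<e} \<subseteq> Gr k"
    and g0: "\<gamma> 0 = Q" and der: "(\<gamma> has_vector_derivative X) (at 0)"
    by (auto simp: tangent_space_def)
  have mem: "0 \<in> {-e<..<e}" and op: "open {-e<..<e}"
    using e by auto
  have "((\<lambda>t. transpose (\<gamma> t)) has_vector_derivative transpose X) (at 0)"
    by (rule bounded_linear.has_vector_derivative[OF bounded_linear_transpose der])
  \<comment> \<open>Near 0 the transposed curve is the curve itself, so uniqueness of the derivative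
    gives symmetry of X. The square of the curve, constantly I, is treated in the same way.\<close>
  then have "(\<gamma> has_vector_derivative transpose X) (at 0)"
    by (rule has_vector_derivative_transform_within_open[OF _ op mem]) (use Gr Gr_D in blast)
  then have sym: "transpose X = X"
    using der vector_derivative_unique_at by blast
  have "((\<lambda>t. \<gamma> t ** \<gamma> t) has_vector_derivative \<gamma> 0 ** X + X ** \<gamma> 0) (at 0)"
    by (rule bounded_bilinear.has_vector_derivative[OF bounded_bilinear_matrix_mult der der])
  then have "((\<lambda>t. mat 1 :: 'n sqmat) has_vector_derivative \<gamma> 0 ** X + X ** \<gamma> 0) (at 0)"
    by (rule has_vector_derivative_transform_within_open[OF _ op mem]) (use Gr Gr_D in blast)
  then have "\<gamma> 0 ** X + X ** \<gamma> 0 = 0"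
    using has_vector_derivative_const vector_derivative_unique_at by blast
  with sym show "X \<in> gr_tangent Q"
    by (simp add: gr_tangent_def g0 add.commute)
qed

text \<open>The curve t |-> R_Q(tX) realizes X. In the form W(t)^2 Q it is differentiated by the
  product rule from the derivative of the resolvent.\<close>

lemma gr_tangent_subset_tangent_space:
  fixes Q :: "'n::finite sqmat"
  assumes Q: "Q \<in> Gr k"
  shows "gr_tangent Q \<subseteq> tangent_space (Gr k) Q"
proof
  fix X
  assume X: "X \<in> gr_tangent Q"
  define L where "L = (1/4) *\<^sub>R (X ** Q)"
  define N where "N = (\<lambda>t. matrix_inv (mat 1 - t *\<^sub>R L))"
  define W where "W = (\<lambda>t. cayley (t *\<^sub>R L))"
  define \<gamma> where "\<gamma> = (\<lambda>t. W t ** W t ** Q)"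
  define W' where "W' = (\<lambda>t. 2 *\<^sub>R (N t ** L ** N t))"
  define \<gamma>' where "\<gamma>' = (\<lambda>t. (W t ** W' t + W' t ** W t) ** Q)"
  note bb = bounded_bilinear_matrix_mult[where 'n='n and 'm='n and 'p='n]
  have L: "transpose L = - L"
    unfolding L_def by (rule gr_tangent_skew[OF Q X])
  have W: "W = (\<lambda>t. 2 *\<^sub>R N t - mat 1)"
    unfolding W_def N_def by (intro ext cayley_resolvent skew_scaleR L)
  have dN: "(N has_vector_derivative N t ** L ** N t) (at t)" for t
    unfolding N_def by (rule has_vector_derivative_skew_resolvent[OF L])
  have cN: "continuous_on S N" for S
    using dN has_vector_derivative_continuous continuous_at_imp_continuous_on by blast
  have dW: "(W has_vector_derivative W' t) (at t)" for t
    unfolding W W'_def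
    using has_vector_derivative_diff_const[of "\<lambda>t. 2 *\<^sub>R N t"]
      bounded_linear.has_vector_derivative[OF bounded_linear_scaleR_right dN] by blast
  have d\<gamma>: "(\<gamma> has_vector_derivative \<gamma>' t) (at t)" for t
    unfolding \<gamma>_def \<gamma>'_def
    by (intro bounded_linear.has_vector_derivative[OF bounded_bilinear.bounded_linear_left[OF bb]]
        bounded_bilinear.has_vector_derivative[OF bb] dW)
  have "continuous_on S \<gamma>'" for S
    unfolding \<gamma>'_def W'_def W
    by (intro bounded_bilinear.continuous_on[OF bb] continuous_intros cN)
  then have C1: "\<gamma> C1_differentiable_on S" for S
    using d\<gamma> unfolding C1_differentiable_on_def by blast
  have Gr: "\<gamma> t \<in> Gr k" for t
  proof -
    have "W t = cayley ((t / 4) *\<^sub>R (X ** Q))"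
      by (simp add: W_def L_def)
    then have "\<gamma> t = W t ** Q ** transpose (W t)"
      unfolding \<gamma>_def using conj_eq_cayley_square[OF Q X] by metis
    also have "\<dots> \<in> Gr k"
      unfolding W_def by (intro Gr_conj Q orthogonal_matrix_cayley skew_scaleR L)
    finally show ?thesis .
  qed
  have N0: "N 0 = mat 1"
    unfolding N_def by (rule matrix_inv_eq) simp
  have W0: "W 0 = mat 1"
    by (simp add: W N0 scaleR_2)
  \<comment> \<open>Each of the two factors W contributes 2L. This 4 cancels the 1/4 in L, and XQQ =
    X.\<close>
  have "\<gamma>' 0 = 4 *\<^sub>R (L ** Q)"
    by (simp add: \<gamma>'_def W'_def N0 W0 matrix_mult_simps flip: scaleR_left_distrib)
  also have "\<dots> = X"
    by (simp add: L_def matrix_mult_simps Gr_D[OF Q] flip: matrix_mul_assoc)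
  finally have "(\<gamma> has_vector_derivative X) (at 0)"
    using d\<gamma>[of 0] by simp
  moreover have "\<gamma> 0 = Q"
    by (simp add: \<gamma>_def W0)
  ultimately show "X \<in> tangent_space (Gr k) Q"
    unfolding tangent_space_def using Gr C1 by (intro CollectI exI[of _ \<gamma>] exI[of _ 1]) auto
qed

lemma tangent_space_Gr: "Q \<in> Gr k \<Longrightarrow> tangent_space (Gr k) Q = gr_tangent Q"
  using gr_tangent_subset_tangent_space tangent_space_Gr_subset by blast

text \<open>Conjugation by W preserves symmetry and the anticommutation relation. With the Cayley
  factor for W, this places the transported vector in the tangent space at R_Q(X).\<close>

lemma gr_tangent_conj:
  fixes W Q :: "'n::finite sqmat"
  assumes W: "orthogonal_matrix W" and Q: "Q \<in> Gr k" and "Y \<in> gr_tangent Q"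
  shows "W ** Y ** transpose W \<in> gr_tangent (W ** Q ** transpose W)"
proof -
  have "(W ** Y ** transpose W) ** (W ** Q ** transpose W) +
      (W ** Q ** transpose W) ** (W ** Y ** transpose W) = W ** (Y ** Q + Q ** Y) ** transpose W"
    by (simp add: matrix_mult_simps orthogonal_matrixD[OF W] flip: matrix_mul_assoc)
  then show ?thesis
    using assms(3) by (simp add: gr_tangent_def transpose_simps matrix_mul_assoc)
qed

section \<open>The retraction and the vector transport in terms of tangent vectors\<close>

lemma orthogonal_matrix_gr_cayley:
  "Q \<in> Gr k \<Longrightarrow> X \<in> gr_tangent Q \<Longrightarrow> orthogonal_matrix (gr_cayley Q X)"
  unfolding gr_cayley_def by (intro orthogonal_matrix_cayley gr_tangent_skew)

lemma gr_cayley_representative: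
  fixes V :: "'n::{finite,linorder} sqmat"
  assumes V: "orthogonal_matrix V"
  shows "gr_cayley (V ** signature_mat k ** transpose V) (V ** sym_block k B ** transpose V)
    = V ** cayley ((1/4) *\<^sub>R skew_block k B) ** transpose V"
proof -
  have "(V ** sym_block k B ** transpose V) ** (V ** signature_mat k ** transpose V) =
      V ** skew_block k B ** transpose V"
    by (simp add: orthogonal_matrixD[OF V] flip: sym_block_mult_signature_mat matrix_mul_assoc)
  then have "(1/4) *\<^sub>R ((V ** sym_block k B ** transpose V) ** (V ** signature_mat k ** transpose V)) =
      V ** ((1/4) *\<^sub>R skew_block k B) ** transpose V"
    by (simp only: matrix_mult_simps)
  then show ?thesis
    unfolding gr_cayley_def
    by (simp only: cayley_conj[OF skew_scaleR[OF transpose_skew_block] V])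
qed

text \<open>The matrix V^T X V is symmetric and anticommutes with the signature matrix, so it has
  the required block form.\<close>

lemma gr_tangent_representative:
  fixes V X :: "'n::{finite,linorder} sqmat"
  assumes V: "orthogonal_matrix V" and "X \<in> gr_tangent (V ** signature_mat k ** transpose V)"
  obtains B where "X = V ** sym_block k B ** transpose V"
proof -
  have X: "X ** (V ** signature_mat k ** transpose V) + (V ** signature_mat k ** transpose V) ** X = 0"
    "transpose X = X"
    using assms(2) by (auto simp: gr_tangent_def)
  let ?Z = "transpose V ** X ** V"
  have "?Z ** signature_mat k + signature_mat k ** ?Z =
      transpose V ** (X ** (V ** signature_mat k ** transpose V) +
        (V ** signature_mat k ** transpose V) ** X) ** V"
    by (simp add: matrix_mult_simps orthogonal_matrixD[OF V] flip: matrix_mul_assoc)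
  then have "?Z ** signature_mat k + signature_mat k ** ?Z = 0"
    by (simp add: X)
  moreover have "transpose ?Z = ?Z"
    by (simp add: transpose_simps X matrix_mul_assoc)
  ultimately obtain B where "?Z = sym_block k B"
    using sym_block_exists by blast
  moreover have "X = V ** ?Z ** transpose V"
    by (simp add: orthogonal_matrixD[OF V] flip: matrix_mul_assoc)
  ultimately show thesis
    using that by metis
qed

text \<open>Every representation of Q and X evaluates to the same expression in
  \<open>gr_cayley Q X\<close>, which is independence of the representation. Conversely each Q and X
  has a representation, so the formula determines R on the whole tangent bundle.\<close>

lemma given_by_retraction_formula_iff:
  fixes R :: "'n::{finite,linorder} sqmat \<Rightarrow> 'n sqmat \<Rightarrow> 'n sqmat"
  shows "given_by_retraction_formula k R \<longleftrightarrow>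
    (\<forall>Q\<in>Gr k. \<forall>X\<in>gr_tangent Q. R Q X = gr_cayley Q X ** Q ** transpose (gr_cayley Q X))"
    (is "?L \<longleftrightarrow> ?R")
proof -
  have eq: "gr_cayley Q X ** Q ** transpose (gr_cayley Q X) =
      V ** cayley ((1/4) *\<^sub>R skew_block k B) ** signature_mat k
        ** transpose (cayley ((1/4) *\<^sub>R skew_block k B)) ** transpose V"
    if "orthogonal_matrix V" "Q = V ** signature_mat k ** transpose V"
      "X = V ** sym_block k B ** transpose V" for Q X V :: "'n sqmat" and B
    unfolding that(2,3) gr_cayley_representative[OF that(1)]
    by (simp add: orthogonal_matrixD[OF that(1)] transpose_simps flip: matrix_mul_assoc)
  show ?thesis
  proof
    assume L: ?L
    show ?R
    proof (intro ballI)
      fix Q X :: "'n sqmat"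
      assume Q: "Q \<in> Gr k" and X: "X \<in> gr_tangent Q"
      obtain V where V: "orthogonal_matrix V" "Q = V ** signature_mat k ** transpose V"
        using Gr_representative[OF Q] .
      obtain B where B: "X = V ** sym_block k B ** transpose V"
        using gr_tangent_representative[OF V(1)] X V(2) by metis
      show "R Q X = gr_cayley Q X ** Q ** transpose (gr_cayley Q X)"
        unfolding eq[OF V B]
        using L Q X V B unfolding given_by_retraction_formula_def tangent_space_Gr[OF Q]
        by (simp add: tangent_space_Gr)
    qed
  next
    assume ?R
    then show ?L
      unfolding given_by_retraction_formula_def by (auto simp: tangent_space_Gr intro: eq)
  qed
qed

lemma given_by_transport_formula_iff:
  fixes T :: "'n::{finite,linorder} sqmat \<Rightarrow> 'n sqmat \<Rightarrow> 'n sqmat \<Rightarrow> 'n sqmat"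
  shows "given_by_transport_formula k T \<longleftrightarrow>
    (\<forall>Q\<in>Gr k. \<forall>X\<in>gr_tangent Q. \<forall>Y\<in>gr_tangent Q.
      T Q X Y = gr_cayley Q X ** Y ** transpose (gr_cayley Q X))"
    (is "?L \<longleftrightarrow> ?R")
proof -
  have eq: "gr_cayley Q X ** Y ** transpose (gr_cayley Q X) =
      V ** cayley ((1/4) *\<^sub>R skew_block k B) ** sym_block k C
        ** transpose (cayley ((1/4) *\<^sub>R skew_block k B)) ** transpose V"
    if "orthogonal_matrix V" "Q = V ** signature_mat k ** transpose V"
      "X = V ** sym_block k B ** transpose V" "Y = V ** sym_block k C ** transpose V"
    for Q X Y V :: "'n sqmat" and B C
    unfolding that(2-4) gr_cayley_representative[OF that(1)]
    by (simp add: orthogonal_matrixD[OF that(1)] transpose_simps flip: matrix_mul_assoc)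
  show ?thesis
  proof
    assume L: ?L
    show ?R
    proof (intro ballI)
      fix Q X Y :: "'n sqmat"
      assume Q: "Q \<in> Gr k" and X: "X \<in> gr_tangent Q" and Y: "Y \<in> gr_tangent Q"
      obtain V where V: "orthogonal_matrix V" "Q = V ** signature_mat k ** transpose V"
        using Gr_representative[OF Q] .
      obtain B where B: "X = V ** sym_block k B ** transpose V"
        using gr_tangent_representative[OF V(1)] X V(2) by metis
      \<comment> \<open>The same V serves for X and Y, since any V diagonalizing Q brings every
        tangent vector at Q to block form.\<close>
      obtain C where C: "Y = V ** sym_block k C ** transpose V"
        using gr_tangent_representative[OF V(1)] Y V(2) by metis
      show "T Q X Y = gr_cayley Q X ** Y ** transpose (gr_cayley Q X)"
        unfolding eq[OF V B C]
        using L[unfolded given_by_transport_formula_def, rule_format, of Q X Y V B C] Q X Y V B C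
        by (simp add: tangent_space_Gr)
    qed
  next
    assume ?R
    then show ?L
      unfolding given_by_transport_formula_def by (auto simp: tangent_space_Gr intro: eq)
  qed
qed

lemma gr_cayley_0: "gr_cayley Q 0 = mat 1"
proof -
  have "matrix_inv (mat 1 :: 'a sqmat) = mat 1"
    by (rule matrix_inv_eq) simp
  then show ?thesis
    by (simp add: gr_cayley_def cayley_def)
qed

lemma retraction_remainder:
  fixes Q X :: "'n::finite sqmat"
  assumes Q: "Q \<in> Gr k" and X: "X \<in> gr_tangent Q"
  defines "L \<equiv> (1/4) *\<^sub>R (X ** Q)" and "W \<equiv> gr_cayley Q X"
  shows "W ** Q ** transpose W - Q - X = L ** L ** ((mat 1 + W) ** (W + 3 *\<^sub>R mat 1) ** Q)"
proof -
  have "4 *\<^sub>R L ** Q = X"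
    by (simp add: L_def matrix_mult_simps Gr_D[OF Q] flip: matrix_mul_assoc)
  moreover have "W ** Q ** transpose W = W ** W ** Q"
    unfolding W_def gr_cayley_def by (rule conj_eq_cayley_square[OF Q X])
  ultimately have "W ** Q ** transpose W - Q - X = (W ** W - mat 1 - 4 *\<^sub>R L) ** Q"
    by (simp add: matrix_mult_simps)
  also have "W ** W - mat 1 - 4 *\<^sub>R L = L ** L ** (mat 1 + W) ** (W + 3 *\<^sub>R mat 1)"
    unfolding W_def gr_cayley_def L_def
    by (rule cayley_square_remainder[OF gr_tangent_skew[OF Q X]])
  finally show ?thesis
    by (simp add: matrix_mul_assoc)
qed

text \<open>In the remainder L L (I + W)(W + 3I) Q the matrix L is linear in X, while W and Q are
  orthogonal and so bounded by n.\<close>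

lemma retraction_remainder_bound:
  fixes Q :: "'n::finite sqmat"
  assumes Q: "Q \<in> Gr k"
  obtains M where "\<And>X. X \<in> gr_tangent Q \<Longrightarrow>
    norm (gr_cayley Q X ** Q ** transpose (gr_cayley Q X) - Q - X) \<le> M * (norm X)\<^sup>2"
proof -
  obtain K where K: "K > 0" "\<And>(A :: 'n sqmat) (B :: 'n sqmat). norm (A ** B) \<le> norm A * norm B * K"
    by (rule norm_matrix_mult_bound) blast
  have mult: "norm (A ** B) \<le> a * b * K" if "norm A \<le> a" "norm B \<le> b" for A B :: "'n sqmat" and a b
  proof -
    have "0 \<le> a"
      using that(1) norm_ge_zero order_trans by blast
    then have "norm A * norm B * K \<le> a * b * K"
      using that K(1) by (intro mult_right_mono mult_mono) auto
    then show ?thesis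
      using K(2)[of A B] by linarith
  qed
  define n where "n = real CARD('n)"
  have I: "norm (mat 1 :: 'n sqmat) \<le> n"
    unfolding n_def by (intro norm_orthogonal_matrix_le orthogonal_matrix_id)
  have nQ: "norm Q \<le> n"
    unfolding n_def by (intro norm_orthogonal_matrix_le Gr_D[OF Q])
  \<comment> \<open>Here |L| \<le> l |X|, and P bounds (I + W)(W + 3I) Q via |I + W| \<le> 2n and |W
    + 3I| \<le> 4n; each matrix product costs one factor K.\<close>
  define l P where "l = 1/4 * (n * K)" and "P = (2 * n) * (4 * n) * K * n * K"
  show thesis
  proof (rule that)
    fix X
    assume X: "X \<in> gr_tangent Q"
    let ?L = "(1/4) *\<^sub>R (X ** Q)" and ?W = "gr_cayley Q X"
    have W: "norm ?W \<le> n"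
      unfolding n_def by (intro norm_orthogonal_matrix_le orthogonal_matrix_gr_cayley[OF Q X])
    have "norm (X ** Q) \<le> norm X * n * K"
      by (intro mult nQ order_refl)
    then have L: "norm ?L \<le> norm X * l"
      by (simp add: l_def)
    have P: "norm ((mat 1 + ?W) ** (?W + 3 *\<^sub>R mat 1) ** Q) \<le> P"
      unfolding P_def using W I
      by (intro mult nQ) (auto intro!: norm_triangle_le)
    have "norm (?W ** Q ** transpose ?W - Q - X) \<le> ((norm X * l) * (norm X * l) * K) * P * K"
      unfolding retraction_remainder[OF Q X] by (intro mult L P)
    then show "norm (?W ** Q ** transpose ?W - Q - X) \<le> (l * l * K * P * K) * (norm X)\<^sup>2"
      by (simp add: power2_eq_square mult_ac)
  qed
qed

lemma zero_in_gr_tangent: "0 \<in> gr_tangent Q"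
  by (simp add: gr_tangent_def vec_eq_iff transpose_def)

text \<open>The transport formula prescribes values on tangent vectors only, so linearity of the
  transport needs linear combinations to stay tangent.\<close>

lemma gr_tangent_lincomb:
  assumes "X \<in> gr_tangent Q" "Y \<in> gr_tangent Q"
  shows "a *\<^sub>R X + b *\<^sub>R Y \<in> gr_tangent Q"
proof -
  have "(a *\<^sub>R X + b *\<^sub>R Y) ** Q + Q ** (a *\<^sub>R X + b *\<^sub>R Y) =
      a *\<^sub>R (X ** Q + Q ** X) + b *\<^sub>R (Y ** Q + Q ** Y)"
    by (simp add: matrix_mult_simps scaleR_right_distrib)
  then show ?thesis
    using assms by (simp add: gr_tangent_def transpose_simps)
qed

lemma retraction_formula_imp_retraction:
  fixes R :: "'n::{finite,linorder} sqmat \<Rightarrow> 'n sqmat \<Rightarrow> 'n sqmat"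
  assumes "given_by_retraction_formula k R"
  shows "manifold_retraction (Gr k) R"
proof -
  have R: "R Q X = gr_cayley Q X ** Q ** transpose (gr_cayley Q X)"
    if "Q \<in> Gr k" "X \<in> gr_tangent Q" for Q X
    using assms that by (simp add: given_by_retraction_formula_iff)
  have R0: "R Q 0 = Q" if "Q \<in> Gr k" for Q
    by (simp add: R[OF that zero_in_gr_tangent] gr_cayley_0)
  have "(R Q has_derivative (\<lambda>v. v)) (at 0 within gr_tangent Q)" if Q: "Q \<in> Gr k" for Q
  proof -
    obtain M where "\<And>X. X \<in> gr_tangent Q \<Longrightarrow>
        norm (gr_cayley Q X ** Q ** transpose (gr_cayley Q X) - Q - X) \<le> M * (norm X)\<^sup>2"
      using retraction_remainder_bound[OF Q] by blast
    then show ?thesis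
      by (intro has_derivative_quadratic_remainder bounded_linear_ident) (simp add: R R0 Q)
  qed
  then show ?thesis
    unfolding manifold_retraction_def
    by (auto simp: tangent_space_Gr R R0 intro!: Gr_conj orthogonal_matrix_gr_cayley[where k=k])
qed

lemma transport_formula_imp_transport:
  fixes R :: "'n::{finite,linorder} sqmat \<Rightarrow> 'n sqmat \<Rightarrow> 'n sqmat"
  assumes "given_by_retraction_formula k R" "given_by_transport_formula k T"
  shows "vector_transport (Gr k) R (\<lambda>(Q, X, Y). (R Q X, T Q X Y))"
proof -
  have R: "R Q X = gr_cayley Q X ** Q ** transpose (gr_cayley Q X)"
    if "Q \<in> Gr k" "X \<in> gr_tangent Q" for Q X
    using assms that by (simp add: given_by_retraction_formula_iff)
  have T: "T Q X Y = gr_cayley Q X ** Y ** transpose (gr_cayley Q X)"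
    if "Q \<in> Gr k" "X \<in> gr_tangent Q" "Y \<in> gr_tangent Q" for Q X Y
    using assms that by (simp add: given_by_transport_formula_iff)
  \<comment> \<open>The point R_Q(X) lies on the Grassmannian again, being an orthogonal conjugate
    of Q.\<close>
  have tan: "tangent_space (Gr k) (R Q X) = gr_tangent (R Q X)"
    if "Q \<in> Gr k" "X \<in> gr_tangent Q" for Q X
    by (intro tangent_space_Gr) (auto simp: R that intro!: Gr_conj orthogonal_matrix_gr_cayley[where k=k])
  have "T Q X Y \<in> gr_tangent (R Q X)"
    if "Q \<in> Gr k" "X \<in> gr_tangent Q" "Y \<in> gr_tangent Q" for Q X Y
    unfolding R[OF that(1,2)] T[OF that]
    by (rule gr_tangent_conj[OF orthogonal_matrix_gr_cayley[OF that(1,2)] that(1,3)])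
  moreover have "T Q 0 Y = Y" if "Q \<in> Gr k" "Y \<in> gr_tangent Q" for Q Y
    by (simp add: T[OF that(1) zero_in_gr_tangent that(2)] gr_cayley_0)
  moreover have "T Q X (a *\<^sub>R Y + b *\<^sub>R Z) = a *\<^sub>R T Q X Y + b *\<^sub>R T Q X Z"
    if "Q \<in> Gr k" "X \<in> gr_tangent Q" "Y \<in> gr_tangent Q" "Z \<in> gr_tangent Q" for Q X Y Z a b
    using that by (simp add: T gr_tangent_lincomb matrix_mult_simps)
  ultimately show ?thesis
    unfolding vector_transport_def using retraction_formula_imp_retraction[OF assms(1)]
    by (simp add: tangent_space_Gr tan)
qed

theorem proposition6p6:
  fixes k :: nat
  assumes "1 \<le> k" and "k \<le> CARD('n::{finite,linorder})"
  shows "(\<exists>R :: 'n sqmat \<Rightarrow> 'n sqmat \<Rightarrow> 'n sqmat. given_by_retraction_formula k R)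
    \<and> (\<exists>T :: 'n sqmat \<Rightarrow> 'n sqmat \<Rightarrow> 'n sqmat \<Rightarrow> 'n sqmat. given_by_transport_formula k T)
    \<and> (\<forall>R :: 'n sqmat \<Rightarrow> 'n sqmat \<Rightarrow> 'n sqmat. given_by_retraction_formula k R \<longrightarrow>
          manifold_retraction (Gr k) R)
    \<and> (\<forall>(R :: 'n sqmat \<Rightarrow> 'n sqmat \<Rightarrow> 'n sqmat) (T :: 'n sqmat \<Rightarrow> 'n sqmat \<Rightarrow> 'n sqmat \<Rightarrow> 'n sqmat).
          given_by_retraction_formula k R \<and> given_by_transport_formula k T \<longrightarrow>
          vector_transport (Gr k) R (\<lambda>(Q, X, Y). (R Q X, T Q X Y)))"
proof (intro conjI allI impI)
  \<comment> \<open>Both witnesses are the expressions free of V, B and C, so existence amounts to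
    the formulas being well defined.\<close>
  show "\<exists>R :: 'n sqmat \<Rightarrow> 'n sqmat \<Rightarrow> 'n sqmat. given_by_retraction_formula k R"
    unfolding given_by_retraction_formula_iff
    by (rule exI[of _ "\<lambda>Q X. gr_cayley Q X ** Q ** transpose (gr_cayley Q X)"]) simp
  show "\<exists>T :: 'n sqmat \<Rightarrow> 'n sqmat \<Rightarrow> 'n sqmat \<Rightarrow> 'n sqmat. given_by_transport_formula k T"
    unfolding given_by_transport_formula_iff
    by (rule exI[of _ "\<lambda>Q X Y. gr_cayley Q X ** Y ** transpose (gr_cayley Q X)"]) simp
qed (auto intro: retraction_formula_imp_retraction transport_formula_imp_transport)

end
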